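(* Let $A$ be the simple graph with vertex set $\{1,2,3,4,5,6,7\}$ and exactly the following $12$ edges: $\{1,2\}$, $\{1,3\}$, $\{1,6\}$, $\{2,4\}$, $\{2,5\}$, $\{3,7\}$, $\{4,7\}$, $\{5,7\}$, $\{6,7\}$, $\{3,4\}$, $\{4,5\}$, $\{5,6\}$. Then $A$ is not word-representable. In particular, not all graphs of vertex degree at most $4$ are word-representable.
   Context: Graphs are finite and simple. Distinct letters $x$ and $y$ alternate in a word $w$ if deleting all other letters from $w$ results in a word of the form $xyxy\cdots$ or $yxyx\cdots$ (of even or odd length). A graph $G=(V,E)$ is word-representable if there exists a finite word $w$ over the alphabet $V$, in which each letter of $V$ occurs at least once, such that for all distinct $x,y\in V$, the letters $x$ and $y$ alternate in $w$ if and only if $\{x,y\}\in E$. *)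

theory Defs
  imports Main
begin

text \<open>Graphs are pairs of a vertex set and a set of edges, each edge being a two-element set.\<close>

type_synonym 'a graph = "'a set \<times> 'a set set"

abbreviation verts :: "'a graph \<Rightarrow> 'a set" where
  "verts G \<equiv> fst G"

abbreviation edges :: "'a graph \<Rightarrow> 'a set set" where
  "edges G \<equiv> snd G"

definition simple_graph :: "'a graph \<Rightarrow> bool" where
  "simple_graph G \<longleftrightarrow> finite (verts G) \<and> (\<forall>e \<in> edges G. e \<subseteq> verts G \<and> card e = 2)"

definition degree :: "'a graph \<Rightarrow> 'a \<Rightarrow> nat" where
  "degree G v = card {e \<in> edges G. v \<in> e}"

text \<open>The word \<open>xyxy\<dots>\<close> of length \<open>n\<close>, where \<open>n\<close> may be even or odd.\<close>

definition alternating_word :: "'a \<Rightarrow> 'a \<Rightarrow> nat \<Rightarrow> 'a list" where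
  "alternating_word x y n = map (\<lambda>i. if even i then x else y) [0..<n]"

definition alternate :: "'a list \<Rightarrow> 'a \<Rightarrow> 'a \<Rightarrow> bool" where
  "alternate w x y \<longleftrightarrow>
     (\<exists>n. filter (\<lambda>z. z = x \<or> z = y) w = alternating_word x y n \<or>
          filter (\<lambda>z. z = x \<or> z = y) w = alternating_word y x n)"

text \<open>The condition \<open>set w = verts G\<close> says both that \<open>w\<close> is a word over the alphabet
  \<open>verts G\<close> and that each vertex occurs in it at least once.\<close>

definition word_representable :: "'a graph \<Rightarrow> bool" where
  "word_representable G \<longleftrightarrow>
     (\<exists>w. set w = verts G \<and>
          (\<forall>x \<in> verts G. \<forall>y \<in> verts G. x \<noteq> y \<longrightarrow> (alternate w x y \<longleftrightarrow> {x, y} \<in> edges G)))"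

definition graph_A :: "nat graph" where
  "graph_A =
     ({1, 2, 3, 4, 5, 6, 7},
      {{1, 2}, {1, 3}, {1, 6}, {2, 4}, {2, 5}, {3, 7},
       {4, 7}, {5, 7}, {6, 7}, {3, 4}, {4, 5}, {5, 6}})"

lemma simple_graph_A: "simple_graph graph_A"
  by (simp add: simple_graph_def graph_A_def)

lemma card_edges_A: "card (edges graph_A) = 12"
  by (simp add: graph_A_def doubleton_eq_iff)

end

(*
  If w represents G, order the vertices by letting x precede y when every prefix of w contains
  at least as many letters x as letters y. This is a partial order in which adjacent vertices
  are comparable; and if x, z are adjacent and y lies between them, then in every prefix the
  number of letters y is squeezed between those of x and z, which differ by at most one, so y
  is adjacent to both x and z. It follows that a 4-cycle of G with a missing diagonal has as many
  edges going up as going down. Give every oriented edge the sign +1 if it goes up and -1 if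
  it goes down. The six such 4-cycles 1243, 1652, 1376, 2574, 3457, 4567 of A then have sign sum 0.
  The first four add up to the triangles 437 and 765, whose sign sums are therefore opposite,
  while by the last two both equal the sign sum of the triangle 457. So this sum
  of three odd numbers vanishes, which is absurd.
*)

theory Submission
  imports Defs
begin

definition prefix_dominates :: "'a list \<Rightarrow> 'a \<Rightarrow> 'a \<Rightarrow> bool" where
  "prefix_dominates w x y \<longleftrightarrow> (\<forall>n. count_list (take n w) y \<le> count_list (take n w) x)"

text \<open>This recasts alternation beginning with \<open>x\<close> in terms of prefix counts: #x -
  #y stays in {0, 1}. In this form it can be compared with \<open>prefix_dominates\<close> across
  three letters.\<close>

definition leads :: "'a list \<Rightarrow> 'a \<Rightarrow> 'a \<Rightarrow> bool" where
  "leads w x y \<longleftrightarrow> prefix_dominates w x y \<and>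
     (\<forall>n. count_list (take n w) x \<le> Suc (count_list (take n w) y))"

lemma all_take_Cons:
  "(\<forall>n. Q (take n (z # w))) \<longleftrightarrow> Q [] \<and> (\<forall>n. Q (z # take n w))"
  by (metis nat.exhaust take_0 take_Suc_Cons)

lemma leads_Nil: "leads [] x y"
  by (simp add: leads_def prefix_dominates_def)

text \<open>Removing a leading \<open>x\<close> shifts the difference #x - #y from {0, 1} to {-1,
  0}, so the two letters exchange roles; a leading \<open>y\<close> would make it -1 at
  once.\<close>

lemma leads_Cons:
  assumes "x \<noteq> y"
  shows "leads (z # w) x y \<longleftrightarrow> z = x \<and> leads w y x \<or> z \<noteq> x \<and> z \<noteq> y \<and> leads w x y"
proof -
  have split: "leads (z # w) x y \<longleftrightarrow>
      (\<forall>n. count_list (z # take n w) y \<le> count_list (z # take n w) x \<and>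
           count_list (z # take n w) x \<le> Suc (count_list (z # take n w) y))"
    unfolding leads_def prefix_dominates_def
    using all_take_Cons[of "\<lambda>u. count_list u y \<le> count_list u x" z w]
      all_take_Cons[of "\<lambda>u. count_list u x \<le> Suc (count_list u y)" z w] by auto
  show ?thesis
  proof (cases "z = y")
    case True
    then have "\<not> leads (z # w) x y"
      using assms unfolding split by (auto intro!: exI[of _ 0])
    then show ?thesis
      using True assms by blast
  next
    case False
    then show ?thesis
      using assms unfolding split by (auto simp: leads_def prefix_dominates_def)
  qed
qed

lemma alternating_word_0: "alternating_word x y 0 = []"
  by (simp add: alternating_word_def)

lemma alternating_word_Suc: "alternating_word x y (Suc n) = x # alternating_word y x n"
  by (simp add: alternating_word_def upt_conv_Cons map_Suc_upt[symmetric] del: upt_Suc)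

lemma Cons_eq_alternating_word_iff:
  "(\<exists>n. z # u = alternating_word x y n) \<longleftrightarrow> z = x \<and> (\<exists>n. u = alternating_word y x n)"
  (is "?L \<longleftrightarrow> ?R")
proof
  assume ?L
  then obtain n where "z # u = alternating_word x y n" ..
  then show ?R
    by (cases n) (auto simp: alternating_word_0 alternating_word_Suc)
next
  assume ?R
  then show ?L
    by (metis alternating_word_Suc)
qed

lemma filter_eq_alternating_word_iff:
  assumes "x \<noteq> y"
  shows "(\<exists>n. filter (\<lambda>z. z = x \<or> z = y) w = alternating_word x y n) \<longleftrightarrow> leads w x y"
  using assms
\<comment> \<open>The letters are generalized because each letter read from the filtered word swaps
  them.\<close>
proof (induction w arbitrary: x y)
  case (Nil x y)
  have "filter (\<lambda>z. z = x \<or> z = y) [] = alternating_word x y 0"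
    by (simp add: alternating_word_0)
  then show ?case
    using leads_Nil[of x y] by (auto intro: exI[of _ 0])
next
  case (Cons z w x y)
  let ?f = "\<lambda>x y w. filter (\<lambda>z. z = x \<or> z = y) w"
  have swap: "?f x y w = ?f y x w"
    by (rule filter_cong) auto
  show ?case
  proof (cases "z = x \<or> z = y")
    case False
    then show ?thesis
      using Cons by (simp add: leads_Cons)
  next
    case True
    then have "?f x y (z # w) = z # ?f y x w"
      by (simp only: filter.simps if_True swap)
    then have "(\<exists>n. ?f x y (z # w) = alternating_word x y n) \<longleftrightarrow>
        z = x \<and> (\<exists>n. ?f y x w = alternating_word y x n)"
      by (simp only: Cons_eq_alternating_word_iff)
    also have "\<dots> \<longleftrightarrow> z = x \<and> leads w y x"
      by (simp only: Cons.IH[OF Cons.prems[symmetric]])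
    also have "\<dots> \<longleftrightarrow> leads (z # w) x y"
      using True Cons.prems by (auto simp: leads_Cons)
    finally show ?thesis .
  qed
qed

lemma alternate_iff_leads:
  assumes "x \<noteq> y"
  shows "alternate w x y \<longleftrightarrow> leads w x y \<or> leads w y x"
proof -
  have swap: "filter (\<lambda>z. z = x \<or> z = y) w = filter (\<lambda>z. z = y \<or> z = x) w"
    by (rule filter_cong) auto
  show ?thesis
    unfolding alternate_def ex_disj_distrib
    using filter_eq_alternating_word_iff[OF assms, of w]
      filter_eq_alternating_word_iff[OF assms[symmetric], of w]
    by (simp add: swap)
qed

lemma prefix_dominates_trans:
  "prefix_dominates w x y \<Longrightarrow> prefix_dominates w y z \<Longrightarrow> prefix_dominates w x z"
  unfolding prefix_dominates_def using le_trans by blast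

lemma prefix_dominates_antisym:
  assumes "x \<in> set w" "prefix_dominates w x y" "prefix_dominates w y x"
  shows "x = y"
proof (rule ccontr)
  assume "x \<noteq> y"
  obtain u v where w: "w = u @ x # v"
    using assms(1) split_list by metis
  have "count_list (take n w) x = count_list (take n w) y" for n
    using assms(2,3) by (simp add: prefix_dominates_def le_antisym)
  \<comment> \<open>Compare the prefixes just before and just after an occurrence of
    \<open>x\<close>: only the count of \<open>x\<close> grows, so the counts cannot agree in
    both.\<close>
  from this[of "length u"] this[of "Suc (length u)"] show False
    using \<open>x \<noteq> y\<close> by (simp add: w)
qed

lemma leads_between:
  assumes "leads w x z" "prefix_dominates w x y" "prefix_dominates w y z"
  shows "leads w x y" "leads w y z"
  using assms unfolding leads_def prefix_dominates_def
  by (meson le_trans Suc_le_mono)+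

text \<open>This collects what is kept of the word once it is discarded. Antisymmetry is asked at
  vertices only, since letters absent from the word dominate each other.\<close>

definition squeezing_order :: "'a graph \<Rightarrow> ('a \<Rightarrow> 'a \<Rightarrow> bool) \<Rightarrow> bool" where
  "squeezing_order G le \<longleftrightarrow>
     (\<forall>x y z. le x y \<longrightarrow> le y z \<longrightarrow> le x z) \<and>
     (\<forall>x \<in> verts G. \<forall>y. le x y \<longrightarrow> le y x \<longrightarrow> x = y) \<and>
     (\<forall>x \<in> verts G. \<forall>y \<in> verts G. x \<noteq> y \<longrightarrow> {x, y} \<in> edges G \<longrightarrow> le x y \<or> le y x) \<and>
     (\<forall>x \<in> verts G. \<forall>y \<in> verts G. \<forall>z \<in> verts G. distinct [x, y, z] \<longrightarrow> {x, z} \<in> edges G \<longrightarrow>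
        le x y \<longrightarrow> le y z \<longrightarrow> {x, y} \<in> edges G \<and> {y, z} \<in> edges G)"

lemma word_representable_imp_squeezing_order:
  assumes "word_representable G"
  shows "\<exists>le. squeezing_order G le"
proof -
  obtain w where set_w: "set w = verts G"
    and rep: "\<And>x y. x \<in> verts G \<Longrightarrow> y \<in> verts G \<Longrightarrow> x \<noteq> y \<Longrightarrow>
      {x, y} \<in> edges G \<longleftrightarrow> leads w x y \<or> leads w y x"
    using assms by (auto simp: word_representable_def alternate_iff_leads)
  \<comment> \<open>The edge gives \<open>leads\<close> in one of the two directions; the reverse
    one would force \<open>x = z\<close> by antisymmetry.\<close>
  have leads_if: "leads w x z"
    if "x \<in> verts G" "z \<in> verts G" "x \<noteq> z" "{x, z} \<in> edges G" "prefix_dominates w x z" for x z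
    using that rep[of x z] set_w prefix_dominates_antisym[of x w z] by (auto simp: leads_def)
  have "squeezing_order G (prefix_dominates w)"
    unfolding squeezing_order_def
  proof (intro conjI ballI allI impI)
    show "prefix_dominates w x z" if "prefix_dominates w x y" "prefix_dominates w y z" for x y z
      using that by (rule prefix_dominates_trans)
    show "x = y" if "x \<in> verts G" "prefix_dominates w x y" "prefix_dominates w y x" for x y
      using that set_w prefix_dominates_antisym by metis
    show "prefix_dominates w x y \<or> prefix_dominates w y x"
      if "x \<in> verts G" "y \<in> verts G" "x \<noteq> y" "{x, y} \<in> edges G" for x y
      using that rep by (auto simp: leads_def)
    fix x y z
    assume *: "x \<in> verts G" "y \<in> verts G" "z \<in> verts G" "distinct [x, y, z]" "{x, z} \<in> edges G"
      "prefix_dominates w x y" "prefix_dominates w y z"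
    then have "leads w x z"
      using leads_if[of x z] prefix_dominates_trans[of w x y z] by auto
    from leads_between[OF this *(6,7)] show "{x, y} \<in> edges G" "{y, z} \<in> edges G"
      using * rep by auto
  qed
  then show ?thesis
    by (intro exI[of _ "prefix_dominates w"])
qed

definition orientation_sign :: "('a \<Rightarrow> 'a \<Rightarrow> bool) \<Rightarrow> 'a \<Rightarrow> 'a \<Rightarrow> int" where
  "orientation_sign le x y = (if le x y then 1 else -1)"

lemma odd_orientation_sign: "odd (orientation_sign le x y)"
  by (simp add: orientation_sign_def)

lemma squeezing_order_flip:
  assumes "squeezing_order G le" "x \<in> verts G" "y \<in> verts G" "x \<noteq> y" "{x, y} \<in> edges G"
  shows "le y x \<longleftrightarrow> \<not> le x y"
  using assms unfolding squeezing_order_def by blast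

lemma orientation_sign_swap:
  assumes "squeezing_order G le" "x \<in> verts G" "y \<in> verts G" "x \<noteq> y" "{x, y} \<in> edges G"
  shows "orientation_sign le y x = - orientation_sign le x y"
  by (simp add: orientation_sign_def squeezing_order_flip[OF assms])

text \<open>Otherwise three consecutive edges go the same way round and form a monotone path p, q,
  r, s whose ends are joined by the fourth edge. Transitivity puts q and r between p and s, so
  squeezing makes both pr and qs edges; one of these is the missing diagonal ac.\<close>

lemma four_cycle_balanced:
  assumes order: "squeezing_order G le"
    and verts: "a \<in> verts G" "b \<in> verts G" "c \<in> verts G" "d \<in> verts G"
    and distinct: "distinct [a, b, c, d]"
    and edges: "{a, b} \<in> edges G" "{b, c} \<in> edges G" "{c, d} \<in> edges G" "{d, a} \<in> edges G"
    and non_edge: "{a, c} \<notin> edges G"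
  shows "orientation_sign le a b + orientation_sign le b c
    + orientation_sign le c d + orientation_sign le d a = 0"
proof -
  have trans: "le x y \<Longrightarrow> le y z \<Longrightarrow> le x z" for x y z
    using order unfolding squeezing_order_def by blast
  have not_between: "\<not> (le x y \<and> le y z)"
    if "x \<in> verts G" "y \<in> verts G" "z \<in> verts G" "distinct [x, y, z]" "{x, z} \<in> edges G"
      "{x, y} \<notin> edges G \<or> {y, z} \<notin> edges G" for x y z
    using order that unfolding squeezing_order_def by blast
  have edges': "{b, a} \<in> edges G" "{c, b} \<in> edges G" "{d, c} \<in> edges G" "{a, d} \<in> edges G"
    "{c, a} \<notin> edges G"
    using edges non_edge by (simp_all add: insert_commute)
  \<comment> \<open>Every side of the cycle contains exactly one of a and c. The other one cannot
    lie between its ends, in either direction, for then ac would be an edge.\<close>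
  have sq: "\<not> (le a c \<and> le c b)" "\<not> (le b c \<and> le c a)" "\<not> (le a c \<and> le c d)"
    "\<not> (le d c \<and> le c a)" "\<not> (le c a \<and> le a b)" "\<not> (le b a \<and> le a c)"
    "\<not> (le c a \<and> le a d)" "\<not> (le d a \<and> le a c)"
    by (rule not_between; use verts distinct edges edges' non_edge in force)+
  have flip: "le b a \<longleftrightarrow> \<not> le a b" "le c b \<longleftrightarrow> \<not> le b c" "le d c \<longleftrightarrow> \<not> le c d" "le a d \<longleftrightarrow> \<not> le d a"
    using order by (rule squeezing_order_flip; use verts distinct edges in force)+
  show ?thesis
    unfolding orientation_sign_def
    using sq flip trans[of a b c] trans[of c b a] trans[of a d c] trans[of c d a]
    by (cases "le a b"; cases "le b c"; cases "le c d"; cases "le d a") simp_all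
qed

lemma not_word_representable_graph_A: "\<not> word_representable graph_A"
proof
  assume "word_representable graph_A"
  then obtain le where order: "squeezing_order graph_A le"
    using word_representable_imp_squeezing_order by blast
  let ?s = "orientation_sign le"
  \<comment> \<open>The starting points matter: the first and third vertices must be non-adjacent.
    In the last three cycles the other diagonal (45, 47, 57) is an edge.\<close>
  have cycles: "?s 1 2 + ?s 2 4 + ?s 4 3 + ?s 3 1 = 0" "?s 1 6 + ?s 6 5 + ?s 5 2 + ?s 2 1 = 0"
    "?s 1 3 + ?s 3 7 + ?s 7 6 + ?s 6 1 = 0" "?s 2 5 + ?s 5 7 + ?s 7 4 + ?s 4 2 = 0"
    "?s 3 4 + ?s 4 5 + ?s 5 7 + ?s 7 3 = 0" "?s 4 5 + ?s 5 6 + ?s 6 7 + ?s 7 4 = 0"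
    using order by (rule four_cycle_balanced; simp add: graph_A_def doubleton_eq_iff)+
  have swap: "?s 2 1 = - ?s 1 2" "?s 3 1 = - ?s 1 3" "?s 6 1 = - ?s 1 6" "?s 4 2 = - ?s 2 4"
    "?s 5 2 = - ?s 2 5" "?s 7 3 = - ?s 3 7" "?s 4 3 = - ?s 3 4" "?s 7 6 = - ?s 6 7"
    "?s 6 5 = - ?s 5 6"
    using order by (rule orientation_sign_swap; simp add: graph_A_def doubleton_eq_iff)+
  have "?s 4 5 + ?s 5 7 + ?s 7 4 = 0"
    using cycles swap by linarith
  moreover have "odd (?s 4 5 + ?s 5 7 + ?s 7 4)"
    by (simp add: odd_orientation_sign)
  ultimately show False
    by simp
qed

theorem mainTheorem2:
  shows "\<not> word_representable graph_A \<and>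
    \<not> (\<forall>G :: nat graph. simple_graph G \<and> (\<forall>v \<in> verts G. degree G v \<le> 4) \<longrightarrow> word_representable G)"
proof -
  \<comment> \<open>As a rewrite rule this computes the set of incident edges one listed edge at a
    time.\<close>
  have incident: "{e \<in> insert a E. v \<in> e} =
      (if v \<in> a then insert a {e \<in> E. v \<in> e} else {e \<in> E. v \<in> e})"
    for a :: "nat set" and E v
    by auto
  have "degree graph_A v \<le> 4" if "v \<in> verts graph_A" for v
  proof -
    have "v \<in> {1, 2, 3, 4, 5, 6, 7}"
      using that by (simp add: graph_A_def)
    then show ?thesis
      unfolding degree_def graph_A_def snd_conv incident
      by (elim insertE emptyE; simp add: card_insert_if doubleton_eq_iff)
  qed
  then show ?thesis
    using not_word_representable_graph_A simple_graph_A by blast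
qed

end
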